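(* Let $(W,S)$ be a finite Coxeter system with Bruhat order $\le$, and let $u\le w$ with $\ell(u,w)=n\ge 1$. Write $\overrightarrow{R}_{uw}(q)=R_{uw}(q+1)$. Then, coefficientwise, \[ q^n\le \overrightarrow{R}_{uw}(q)\le d_n(q)\quad\text{and}\quad nq^{n-1}\le \overrightarrow{R}_{uw}{}'(q)\le d_n'(q), \] where $d_0(q)=1$, $d_1(q)=q$, $d_2(q)=q^2$, $d_m(q)=q\,d_{m-1}(q)+(q+1)\,d_{m-2}(q)$ for $m\ge3$, and $'$ is the formal derivative in $q$. Moreover, \[ d_n(q)=\frac{q}{q+2}\bigl((q+1)^n-(-1)^n\bigr),\qquad d_n'(q)=\frac{2}{(q+2)^2}\bigl((q+1)^n-(-1)^n\bigr)+\frac{nq}{q+2}(q+1)^{n-1}. \]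
   Context: $\ell$ is the length function and $\ell(u,w)=\ell(w)-\ell(u)$. The $R$-polynomials $R_{uw}(q)\in\mathbb{Z}[q]$ are the unique family with $R_{uw}=0$ if $u\not\le w$, $R_{uu}=1$, and, for $s\in S$ with $\ell(ws)<\ell(w)$: $R_{uw}=R_{us,ws}$ if $\ell(us)<\ell(u)$, $R_{uw}=(q-1)R_{u,ws}+qR_{us,ws}$ if $\ell(us)>\ell(u)$. For polynomials with nonnegative integer coefficients, $f\le g$ means coefficientwise inequality. *)

theory Defs
  imports
    "HOL-Algebra.Generated_Groups"
    "HOL-Library.Extended_Nat"
    "HOL-Computational_Algebra.Polynomial_Factorial"
begin

section \<open>Coxeter systems\<close>

definition word_prod :: "('a, 'b) monoid_scheme \<Rightarrow> 'a list \<Rightarrow> 'a" where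
  "word_prod G xs = foldr (\<lambda>x y. x \<otimes>\<^bsub>G\<^esub> y) xs \<one>\<^bsub>G\<^esub>"

text \<open>
  A group word over \<open>S\<close> is a list of pairs: \<open>(s, True)\<close> is the letter \<open>s\<close>
  and \<open>(s, False)\<close> is its formal inverse. Two group words are equivalent iff they represent
  the same element of the quotient of the free group on \<open>S\<close> by the normal closure
  of the relators \<open>R\<close>.
\<close>

inductive pres_equiv ::
    "'a set \<Rightarrow> ('a \<times> bool) list set \<Rightarrow> ('a \<times> bool) list \<Rightarrow> ('a \<times> bool) list \<Rightarrow> bool"
  for S R where
  pres_refl: "pres_equiv S R xs xs"
| pres_sym: "pres_equiv S R xs ys \<Longrightarrow> pres_equiv S R ys xs"
| pres_trans: "pres_equiv S R xs ys \<Longrightarrow> pres_equiv S R ys zs \<Longrightarrow> pres_equiv S R xs zs"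
| pres_cancel: "s \<in> S \<Longrightarrow> pres_equiv S R (xs @ [(s, b), (s, \<not> b)] @ ys) (xs @ ys)"
| pres_relator: "r \<in> R \<Longrightarrow> pres_equiv S R (xs @ r @ ys) (xs @ ys)"

definition group_word_prod :: "('a, 'b) monoid_scheme \<Rightarrow> ('a \<times> bool) list \<Rightarrow> 'a" where
  "group_word_prod G xs = word_prod G (map (\<lambda>(s, b). if b then s else inv\<^bsub>G\<^esub> s) xs)"

definition has_presentation ::
    "('a, 'b) monoid_scheme \<Rightarrow> 'a set \<Rightarrow> ('a \<times> bool) list set \<Rightarrow> bool" where
  "has_presentation G S R \<longleftrightarrow>
     group G \<and> S \<subseteq> carrier G \<and> generate G S = carrier G \<and> R \<subseteq> lists (S \<times> UNIV) \<and>
     (\<forall>xs \<in> lists (S \<times> UNIV). group_word_prod G xs = \<one>\<^bsub>G\<^esub> \<longleftrightarrow> pres_equiv S R xs [])"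

definition coxeter_matrix :: "'a set \<Rightarrow> ('a \<Rightarrow> 'a \<Rightarrow> enat) \<Rightarrow> bool" where
  "coxeter_matrix S m \<longleftrightarrow>
     (\<forall>s \<in> S. \<forall>t \<in> S. 1 \<le> m s t \<and> m s t = m t s \<and> (m s t = 1 \<longleftrightarrow> s = t))"

definition coxeter_relators :: "'a set \<Rightarrow> ('a \<Rightarrow> 'a \<Rightarrow> enat) \<Rightarrow> ('a \<times> bool) list set" where
  "coxeter_relators S m =
     {concat (replicate k [(s, True), (t, True)]) | s t k. s \<in> S \<and> t \<in> S \<and> m s t = enat k}"

definition coxeter_system :: "('a, 'b) monoid_scheme \<Rightarrow> 'a set \<Rightarrow> bool" where
  "coxeter_system G S \<longleftrightarrow>
     (\<exists>m. coxeter_matrix S m \<and> has_presentation G S (coxeter_relators S m))"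


section \<open>Length and Bruhat order\<close>

definition cox_length :: "('a, 'b) monoid_scheme \<Rightarrow> 'a set \<Rightarrow> 'a \<Rightarrow> nat" where
  "cox_length G S w = (LEAST k. \<exists>xs \<in> lists S. length xs = k \<and> word_prod G xs = w)"

definition length_diff :: "('a, 'b) monoid_scheme \<Rightarrow> 'a set \<Rightarrow> 'a \<Rightarrow> 'a \<Rightarrow> int" where
  "length_diff G S u w = int (cox_length G S w) - int (cox_length G S u)"

definition reflections :: "('a, 'b) monoid_scheme \<Rightarrow> 'a set \<Rightarrow> 'a set" where
  "reflections G S = {g \<otimes>\<^bsub>G\<^esub> s \<otimes>\<^bsub>G\<^esub> inv\<^bsub>G\<^esub> g | g s. g \<in> carrier G \<and> s \<in> S}"

definition bruhat_le :: "('a, 'b) monoid_scheme \<Rightarrow> 'a set \<Rightarrow> 'a \<Rightarrow> 'a \<Rightarrow> bool" where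
  "bruhat_le G S u w \<longleftrightarrow> u \<in> carrier G \<and> w \<in> carrier G \<and>
     (u, w) \<in> {(x, x \<otimes>\<^bsub>G\<^esub> t) | x t. x \<in> carrier G \<and> t \<in> reflections G S \<and>
                 cox_length G S x < cox_length G S (x \<otimes>\<^bsub>G\<^esub> t)}\<^sup>*"


section \<open>R-polynomials\<close>

text \<open>
  Since \<^const>\<open>bruhat_le\<close> only relates elements of the carrier, the first condition also fixes
  the value 0 for arguments outside the carrier; this makes the family unique as a function
  on the whole type.
\<close>

definition is_R_family :: "('a, 'b) monoid_scheme \<Rightarrow> 'a set \<Rightarrow> ('a \<Rightarrow> 'a \<Rightarrow> int poly) \<Rightarrow> bool" where
  "is_R_family G S R \<longleftrightarrow>
     (\<forall>u w. \<not> bruhat_le G S u w \<longrightarrow> R u w = 0) \<and>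
     (\<forall>u \<in> carrier G. R u u = 1) \<and>
     (\<forall>u \<in> carrier G. \<forall>w \<in> carrier G. \<forall>s \<in> S.
        cox_length G S (w \<otimes>\<^bsub>G\<^esub> s) < cox_length G S w \<longrightarrow>
        (cox_length G S (u \<otimes>\<^bsub>G\<^esub> s) < cox_length G S u \<longrightarrow>
           R u w = R (u \<otimes>\<^bsub>G\<^esub> s) (w \<otimes>\<^bsub>G\<^esub> s)) \<and>
        (cox_length G S (u \<otimes>\<^bsub>G\<^esub> s) > cox_length G S u \<longrightarrow>
           R u w = [:-1, 1:] * R u (w \<otimes>\<^bsub>G\<^esub> s) + [:0, 1:] * R (u \<otimes>\<^bsub>G\<^esub> s) (w \<otimes>\<^bsub>G\<^esub> s)))"

definition R_poly :: "('a, 'b) monoid_scheme \<Rightarrow> 'a set \<Rightarrow> 'a \<Rightarrow> 'a \<Rightarrow> int poly" where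
  "R_poly G S = (THE R. is_R_family G S R)"

definition shifted_R_poly :: "('a, 'b) monoid_scheme \<Rightarrow> 'a set \<Rightarrow> 'a \<Rightarrow> 'a \<Rightarrow> int poly" where
  "shifted_R_poly G S u w = pcompose (R_poly G S u w) [:1, 1:]"


section \<open>The bounding polynomials\<close>

text \<open>
  The order that the library puts on \<^typ>\<open>int poly\<close> compares leading coefficients, so
  coefficientwise comparison needs its own symbol.
\<close>

definition coeffwise_le :: "int poly \<Rightarrow> int poly \<Rightarrow> bool" (infix "\<preceq>\<^sub>c" 50) where
  "f \<preceq>\<^sub>c g \<longleftrightarrow> (\<forall>i. coeff f i \<le> coeff g i)"

fun d_poly :: "nat \<Rightarrow> int poly" where
  "d_poly 0 = 1"
| "d_poly (Suc 0) = [:0, 1:]"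
| "d_poly (Suc (Suc 0)) = [:0, 1:] ^ 2"
| "d_poly (Suc (Suc (Suc m))) = [:0, 1:] * d_poly (Suc (Suc m)) + [:1, 1:] * d_poly (Suc m)"

end

theory Submission
  imports Defs
begin

text \<open>
  Strong exchange comes from a parity attached to a word and a reflection, namely that of the
  number of letters whose deletion amounts to multiplying by the reflection; inserting a relator
  does not change it, so it only depends on the group element. Strong exchange yields the lifting
  property of the Bruhat order.

  The R-polynomials exist because their recursion is the action of (a multiple of) the inverses of
  Hecke generators on functions on the group. Left and right Hecke operators commute, hence the
  result of applying the operators along a reduced word depends only on its product.

  After the substitution \<open>q \<mapsto> q + 1\<close> the recursion reads \<open>R u w = q R u (ws) + (q + 1) R (us) (ws)\<close>
  if \<open>us > u\<close>, with nonnegative coefficients, where \<open>u \<le> ws\<close> by lifting. Induction along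
  descents of \<open>w\<close> gives both bounds; the second term vanishes for length difference at most two,
  which accounts for the exceptional value \<open>d\<^sub>2 = q\<^sup>2\<close>.
\<close>

text \<open>Word membership in \<open>lists S\<close> is kept atomic, so that it matches the side conditions below.\<close>

declare in_listsD [rule del] in_listsI [rule del]

lemma rev_in_lists [simp]: "rev a \<in> lists A \<longleftrightarrow> a \<in> lists A"
  by (simp add: in_lists_conv_set)

lemma map_fst_in_lists: "xs \<in> lists (A \<times> B) \<Longrightarrow> map fst xs \<in> lists A"
  by (induction xs) auto

section \<open>Words in the generators of a Coxeter group\<close>

locale coxeter = group G for G (structure) +
  fixes S :: "'a set"
  assumes coxeter_system: "coxeter_system G S"
begin

abbreviation wp :: "'a list \<Rightarrow> 'a" where "wp \<equiv> word_prod G"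
abbreviation len :: "'a \<Rightarrow> nat" where "len \<equiv> cox_length G S"

lemma wp_Nil [simp]: "wp [] = \<one>" and wp_Cons [simp]: "wp (x # xs) = x \<otimes> wp xs"
  by (simp_all add: word_prod_def)

lemma S_closed [simp, intro]: "s \<in> S \<Longrightarrow> s \<in> carrier G"
  using coxeter_system by (auto simp: coxeter_system_def has_presentation_def)

lemma wp_closed [simp, intro]: "a \<in> lists S \<Longrightarrow> wp a \<in> carrier G"
  by (induction a) auto

lemma wp_append: "a \<in> lists S \<Longrightarrow> b \<in> lists S \<Longrightarrow> wp (a @ b) = wp a \<otimes> wp b"
  by (induction a) (auto simp: m_assoc)

text \<open>The diagonal entry 1 of the Coxeter matrix makes \<open>ss\<close> a relator, and
  relators evaluate to the identity.\<close>

lemma S_square [simp]: "s \<in> S \<Longrightarrow> s \<otimes> s = \<one>"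
proof -
  assume s: "s \<in> S"
  obtain m where m: "coxeter_matrix S m" "has_presentation G S (coxeter_relators S m)"
    using coxeter_system by (auto simp: coxeter_system_def)
  have "concat (replicate 1 [(s, True), (s, True)]) \<in> coxeter_relators S m"
    unfolding coxeter_relators_def using s m(1)
    by (fastforce simp: coxeter_matrix_def one_enat_def)
  then have "pres_equiv S (coxeter_relators S m) ([] @ [(s, True), (s, True)] @ []) ([] @ [])"
    by (intro pres_relator) simp
  then have "group_word_prod G [(s, True), (s, True)] = \<one>"
    using m(2) s by (auto simp: has_presentation_def)
  then show ?thesis using s by (simp add: group_word_prod_def)
qed

lemma S_inv [simp]: "s \<in> S \<Longrightarrow> inv s = s"
  by (metis S_closed S_square inv_equality)

lemma S_cancel_left [simp]: "s \<in> S \<Longrightarrow> x \<in> carrier G \<Longrightarrow> s \<otimes> (s \<otimes> x) = x"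
  by (simp flip: m_assoc)

lemma S_cancel_right [simp]: "s \<in> S \<Longrightarrow> x \<in> carrier G \<Longrightarrow> x \<otimes> s \<otimes> s = x"
  by (simp add: m_assoc)

lemma wp_rev: "a \<in> lists S \<Longrightarrow> wp (rev a) = inv (wp a)"
  by (induction a) (auto simp: wp_append inv_mult_group)

lemma pow_mult_comm: "x \<in> carrier G \<Longrightarrow> x [^] (n::nat) \<otimes> x = x \<otimes> x [^] n"
  by (metis nat_pow_Suc nat_pow_Suc2)

lemma wp_alternating:
  "s \<in> S \<Longrightarrow> t \<in> S \<Longrightarrow> wp (concat (replicate k [s, t])) = (s \<otimes> t) [^] k"
  by (induction k) (simp_all add: pow_mult_comm m_assoc)

lemma alternating_lists:
  "s \<in> S \<Longrightarrow> t \<in> S \<Longrightarrow> concat (replicate k [s, t]) \<in> lists S"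
  by (induction k) auto

lemma group_word_prod_eq:
  "xs \<in> lists (S \<times> UNIV) \<Longrightarrow> group_word_prod G xs = wp (map fst xs)"
  unfolding group_word_prod_def by (rule arg_cong[where f = wp]) (auto simp: in_lists_conv_set)

text \<open>
  The cancellations of the presentation need no separate hypothesis, because \<open>ss\<close> is itself
  a relator.
\<close>

lemma word_invariant:
  assumes inv: "\<And>xs ys s t k. \<lbrakk>xs \<in> lists S; ys \<in> lists S; s \<in> S; t \<in> S; (s \<otimes> t) [^] (k::nat) = \<one>\<rbrakk>
      \<Longrightarrow> P (xs @ concat (replicate k [s, t]) @ ys) = P (xs @ ys)"
    and a: "a \<in> lists S" "wp a = \<one>"
  shows "P a = P []"
proof -
  obtain m where m: "has_presentation G S (coxeter_relators S m)"
    using coxeter_system by (auto simp: coxeter_system_def)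
  let ?R = "coxeter_relators S m" and ?L = "lists (S \<times> (UNIV :: bool set))"
  \<comment> \<open>Membership in the alphabet is part of the claim because in the transitivity case
    it has to reach the intermediate word.\<close>
  have "(xs \<in> ?L \<longleftrightarrow> ys \<in> ?L) \<and> (xs \<in> ?L \<longrightarrow> P (map fst xs) = P (map fst ys))"
    if "pres_equiv S ?R xs ys" for xs ys
    using that
  proof induction
    case (pres_cancel s xs b ys)
    show ?case
    proof (intro conjI impI)
      assume "xs @ [(s, b), (s, \<not> b)] @ ys \<in> ?L"
      then have "map fst xs \<in> lists S" "map fst ys \<in> lists S"
        by (auto intro: map_fst_in_lists)
      from inv[OF this pres_cancel pres_cancel, of 1] pres_cancel
      show "P (map fst (xs @ [(s, b), (s, \<not> b)] @ ys)) = P (map fst (xs @ ys))" by simp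
    qed (use pres_cancel in auto)
  next
    case (pres_relator r xs ys)
    then obtain s t k where r: "r = concat (replicate k [(s, True), (t, True)])" "s \<in> S" "t \<in> S"
      by (auto simp: coxeter_relators_def)
    have rL: "r \<in> ?L" using m pres_relator unfolding has_presentation_def by blast
    have fst_r: "map fst r = concat (replicate k [s, t])" by (simp add: r map_concat)
    have "pres_equiv S ?R ([] @ r @ []) ([] @ [])"
      using pres_relator by (rule pres_equiv.pres_relator)
    then have "group_word_prod G r = \<one>" using m rL by (simp add: has_presentation_def)
    then have one: "(s \<otimes> t) [^] k = \<one>"
      using r rL fst_r by (simp add: group_word_prod_eq wp_alternating)
    show ?case
    proof (intro conjI impI)
      assume "xs @ r @ ys \<in> ?L"
      then have "map fst xs \<in> lists S" "map fst ys \<in> lists S"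
        by (auto intro: map_fst_in_lists)
      from inv[OF this r(2,3) one]
      show "P (map fst (xs @ r @ ys)) = P (map fst (xs @ ys))" by (simp add: fst_r)
    qed (use rL in auto)
  qed auto
  note * = this
  let ?xs = "map (\<lambda>s. (s, True)) a"
  have xs: "?xs \<in> ?L" using a(1) by (auto simp: in_lists_conv_set)
  moreover have fst: "map fst ?xs = a" by (simp add: comp_def)
  ultimately have "group_word_prod G ?xs = \<one>" using a(2) by (simp add: group_word_prod_eq)
  then have "pres_equiv S ?R ?xs []" using m xs by (simp add: has_presentation_def)
  from *[OF this] xs fst show ?thesis by simp
qed

lemma ex_word: "w \<in> carrier G \<Longrightarrow> \<exists>a \<in> lists S. wp a = w"
proof -
  assume "w \<in> carrier G"
  then have "w \<in> generate G S"
    using coxeter_system by (auto simp: coxeter_system_def has_presentation_def)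
  then show ?thesis
  proof induction
    case one
    show ?case by (intro bexI[of _ "[]"]) auto
  next
    case (incl s)
    then show ?case by (intro bexI[of _ "[s]"]) auto
  next
    case (inv s)
    then show ?case by (intro bexI[of _ "[s]"]) auto
  next
    case (eng x y)
    then obtain a b where "a \<in> lists S" "b \<in> lists S" "wp a = x" "wp b = y" by blast
    then show ?case by (intro bexI[of _ "a @ b"]) (auto simp: wp_append)
  qed
qed

text \<open>Relators have even length, so inserting one preserves the parity of the length; this is
  applied to \<open>a @ rev b\<close>, which represents the identity.\<close>

lemma even_length_eq:
  assumes "a \<in> lists S" "b \<in> lists S" "wp a = wp b"
  shows "even (length a) = even (length b)"
proof -
  have "even (length (a @ rev b)) = even (length ([] :: 'a list))"
    by (rule word_invariant)
      (use assms in \<open>auto simp: wp_append wp_rev length_concat sum_list_replicate\<close>)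
  then show ?thesis by simp
qed

section \<open>The length function\<close>

lemma len_le: "a \<in> lists S \<Longrightarrow> len (wp a) \<le> length a"
  unfolding cox_length_def by (rule Least_le) auto

lemma ex_reduced:
  assumes "w \<in> carrier G"
  obtains a where "a \<in> lists S" "wp a = w" "length a = len w"
proof -
  obtain b where "b \<in> lists S" "wp b = w" using ex_word[OF assms] by blast
  then have "\<exists>a \<in> lists S. length a = length b \<and> wp a = w" by blast
  then have "\<exists>a \<in> lists S. length a = len w \<and> wp a = w"
    unfolding cox_length_def by (rule LeastI)
  then show ?thesis using that by blast
qed

lemma even_len: "a \<in> lists S \<Longrightarrow> even (len (wp a)) = even (length a)"
  by (metis even_length_eq ex_reduced wp_closed)

lemma len_one [simp]: "len \<one> = 0"
  using len_le[of "[]"] by simp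

lemma len_inv: "w \<in> carrier G \<Longrightarrow> len (inv w) = len w"
proof -
  have "len (inv w) \<le> len w" if "w \<in> carrier G" for w
    using that by (metis ex_reduced len_le length_rev rev_in_lists wp_rev)
  then show "w \<in> carrier G \<Longrightarrow> len (inv w) = len w"
    by (metis inv_closed inv_inv le_antisym)
qed

lemma even_len_mult:
  "v \<in> carrier G \<Longrightarrow> w \<in> carrier G \<Longrightarrow> even (len (v \<otimes> w)) = even (len v + len w)"
  by (metis append_in_lists_conv even_len even_add ex_reduced length_append wp_append)

lemma len_mult_le: "v \<in> carrier G \<Longrightarrow> w \<in> carrier G \<Longrightarrow> len (v \<otimes> w) \<le> len v + len w"
  by (metis append_in_lists_conv ex_reduced len_le length_append wp_append)

lemma len_S [simp]: "s \<in> S \<Longrightarrow> len s = 1"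
proof -
  assume "s \<in> S"
  then have "len s \<le> 1" "odd (len s)" using len_le[of "[s]"] even_len[of "[s]"] by auto
  then show ?thesis by (cases "len s") auto
qed

text \<open>One letter changes the length by at most one, and parity rules out equality.\<close>

lemma len_mult_S:
  assumes "w \<in> carrier G" "s \<in> S"
  shows "len (w \<otimes> s) = Suc (len w) \<or> len w = Suc (len (w \<otimes> s))"
proof -
  have "len (w \<otimes> s) \<le> len w + 1" "len w \<le> len (w \<otimes> s) + 1"
    using len_mult_le[of w s] len_mult_le[of "w \<otimes> s" s] assms by auto
  moreover have "even (len (w \<otimes> s)) \<noteq> even (len w)"
    using even_len_mult[of w s] assms by auto
  ultimately show ?thesis by presburger
qed

lemma len_S_mult:
  assumes "w \<in> carrier G" "s \<in> S"
  shows "len (s \<otimes> w) = Suc (len w) \<or> len w = Suc (len (s \<otimes> w))"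
  using len_mult_S[of "inv w" s] len_inv[of w] len_inv[of "s \<otimes> w"] assms
  by (simp add: inv_mult_group)

lemma ex_right_descent:
  assumes "w \<in> carrier G" "w \<noteq> \<one>"
  obtains s where "s \<in> S" "len (w \<otimes> s) < len w"
proof -
  obtain a where a: "a \<in> lists S" "wp a = w" "length a = len w" using ex_reduced assms(1) .
  then obtain b s where b: "a = b @ [s]" using assms(2) by (cases a rule: rev_cases) auto
  then have "w \<otimes> s = wp b" using a by (auto simp: wp_append)
  then show ?thesis using len_le[of b] a b that[of s] by auto
qed

section \<open>Strong exchange\<close>

lemma reflection_closed: "t \<in> reflections G S \<Longrightarrow> t \<in> carrier G"
  by (auto simp: reflections_def)

lemma reflection_square: "t \<in> reflections G S \<Longrightarrow> t \<otimes> t = \<one>"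
proof -
  assume "t \<in> reflections G S"
  then obtain g s where "t = g \<otimes> s \<otimes> inv g" "g \<in> carrier G" "s \<in> S"
    by (auto simp: reflections_def)
  then show ?thesis by (simp add: m_assoc) (simp flip: m_assoc)
qed

text \<open>
  \<open>refl_parity a t\<close> is the parity of the number of positions of the word \<open>a\<close> whose deletion
  has the effect of multiplying \<open>wp a\<close> by \<open>t\<close> on the right.
\<close>

primrec refl_parity :: "'a list \<Rightarrow> 'a \<Rightarrow> bool" where
  "refl_parity [] t = False"
| "refl_parity (s # a) t = (refl_parity a t \<noteq> (t = inv (wp a) \<otimes> s \<otimes> wp a))"

lemma conj_eq_iff:
  assumes "x \<in> carrier G" "y \<in> carrier G" "z \<in> carrier G"
  shows "x = inv z \<otimes> y \<otimes> z \<longleftrightarrow> z \<otimes> x \<otimes> inv z = y"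
  using assms by (metis inv_closed inv_solve_left inv_solve_right m_assoc m_closed)

text \<open>Moving \<open>t\<close> leftwards past \<open>wp b\<close> conjugates it, so the letters
  of \<open>a\<close> are counted for the conjugate.\<close>

lemma refl_parity_append:
  assumes "a \<in> lists S" "b \<in> lists S" "t \<in> carrier G"
  shows "refl_parity (a @ b) t = (refl_parity b t \<noteq> refl_parity a (wp b \<otimes> t \<otimes> inv (wp b)))"
  using assms(1)
proof (induction a)
  case (Cons s a)
  let ?x = "wp a" and ?y = "wp b"
  have c: "?x \<in> carrier G" "?y \<in> carrier G" "s \<in> carrier G" using Cons assms by auto
  have "t = inv (?x \<otimes> ?y) \<otimes> s \<otimes> (?x \<otimes> ?y) \<longleftrightarrow> ?y \<otimes> t \<otimes> inv ?y = inv ?x \<otimes> s \<otimes> ?x"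
    using c assms(3) conj_eq_iff[of "?y \<otimes> t \<otimes> inv ?y" s ?x] conj_eq_iff[of t s "?x \<otimes> ?y"]
    by (simp add: inv_mult_group m_assoc)
  then show ?case using Cons assms by (auto simp: wp_append)
qed (use assms in auto)

primrec count_parity :: "(nat \<Rightarrow> bool) \<Rightarrow> nat \<Rightarrow> bool" where
  "count_parity Q 0 = False"
| "count_parity Q (Suc n) = (count_parity Q n \<noteq> Q n)"

text \<open>By periodicity, the last \<open>m\<close> indices can be shifted back by
  \<open>k\<close>.\<close>

lemma count_parity_add:
  "(\<And>i. Q (k + i) = Q i) \<Longrightarrow> count_parity Q (k + m) = (count_parity Q k \<noteq> count_parity Q m)"
  by (induction m) auto

text \<open>Counting letters of \<open>(sr)^k\<close> from the right, starting with 0, the deletion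
  of letter \<open>i\<close> amounts to multiplication by \<open>r (sr)^i\<close>.\<close>

lemma refl_parity_alternating:
  assumes "s \<in> S" "r \<in> S" "t \<in> carrier G"
  shows "refl_parity (concat (replicate k [s, r])) t
    = count_parity (\<lambda>i. t = r \<otimes> (s \<otimes> r) [^] i) (2 * k)"
proof (induction k)
  case (Suc k)
  let ?p = "s \<otimes> r"
  have c: "s \<in> carrier G" "r \<in> carrier G" "?p \<in> carrier G" using assms by auto
  \<comment> \<open>Conjugation by \<open>r\<close> inverts \<open>sr\<close>, since
    \<open>rs\<close> is the inverse of \<open>sr\<close>.\<close>
  have inv_pow: "inv (?p [^] i) \<otimes> r = r \<otimes> ?p [^] i" for i :: nat
  proof (induction i)
    case (Suc i)
    have "inv (?p [^] Suc i) \<otimes> r = inv ?p \<otimes> (inv (?p [^] i) \<otimes> r)"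
      using c by (simp add: inv_mult_group m_assoc nat_pow_Suc)
    also have "\<dots> = r \<otimes> (?p \<otimes> ?p [^] i)"
      using assms c by (simp add: Suc inv_mult_group m_assoc)
    finally show ?case using c by (simp add: pow_mult_comm)
  qed (use c in auto)
  have e1: "inv (?p [^] k) \<otimes> r \<otimes> ?p [^] k = r \<otimes> ?p [^] (2 * k)"
    using c by (simp add: inv_pow m_assoc nat_pow_mult mult_2)
  have "inv (r \<otimes> ?p [^] k) \<otimes> s \<otimes> (r \<otimes> ?p [^] k) = inv (?p [^] k) \<otimes> r \<otimes> (s \<otimes> (r \<otimes> ?p [^] k))"
    using assms c by (simp add: inv_mult_group m_assoc)
  also have "\<dots> = r \<otimes> (?p [^] k \<otimes> (?p \<otimes> ?p [^] k))"
    using c by (simp add: inv_pow m_assoc)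
  also have "?p [^] k \<otimes> (?p \<otimes> ?p [^] k) = ?p [^] (2 * k + 1)"
    using c by (simp add: nat_pow_mult mult_2 flip: pow_mult_comm m_assoc)
  finally have e2: "inv (r \<otimes> ?p [^] k) \<otimes> s \<otimes> (r \<otimes> ?p [^] k) = r \<otimes> ?p [^] (2 * k + 1)" .
  show ?case
    using assms Suc e1 e2 by (simp add: wp_alternating del: nat_pow_Suc)
qed simp

text \<open>If \<open>(sr)^k = 1\<close>, the elements \<open>r (sr)^i\<close> repeat with period
  \<open>k\<close>, so the two halves of the \<open>2k\<close> letters contribute the same parity
  and cancel.\<close>

lemma refl_parity_relator:
  assumes "s \<in> S" "r \<in> S" "t \<in> carrier G" and one: "(s \<otimes> r) [^] (k::nat) = \<one>"
  shows "\<not> refl_parity (concat (replicate k [s, r])) t"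
proof -
  let ?Q = "\<lambda>i. t = r \<otimes> (s \<otimes> r) [^] i"
  have "?Q (k + i) = ?Q i" for i
    using assms by (simp flip: nat_pow_mult)
  then have "count_parity ?Q (k + k) = (count_parity ?Q k \<noteq> count_parity ?Q k)"
    by (rule count_parity_add)
  then show ?thesis using assms by (simp add: refl_parity_alternating mult_2)
qed

text \<open>An inserted relator has even parity itself and leaves the conjugating element in
  \<open>refl_parity_append\<close> unchanged, so the parity equals that of the empty word.\<close>

lemma refl_parity_one:
  assumes "a \<in> lists S" "wp a = \<one>" "t \<in> carrier G"
  shows "\<not> refl_parity a t"
proof -
  have "refl_parity a t = refl_parity [] t"
  proof (rule word_invariant[where P = "\<lambda>a. refl_parity a t"])
    fix xs ys s r and k :: nat
    assume *: "xs \<in> lists S" "ys \<in> lists S" "s \<in> S" "r \<in> S" "(s \<otimes> r) [^] k = \<one>"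
    show "refl_parity (xs @ concat (replicate k [s, r]) @ ys) t = refl_parity (xs @ ys) t"
      using * assms alternating_lists[of s r k]
      by (simp add: refl_parity_append wp_append wp_alternating refl_parity_relator)
  qed (use assms in auto)
  then show ?thesis by simp
qed

text \<open>Both \<open>a @ rev b\<close> and \<open>b @ rev b\<close> represent the identity. At
  \<open>t\<close> conjugated by \<open>wp b\<close> the common part \<open>rev b\<close>
  contributes equally, while \<open>a\<close> and \<open>b\<close> are evaluated at
  \<open>t\<close>.\<close>

lemma refl_parity_cong:
  assumes "a \<in> lists S" "b \<in> lists S" "wp a = wp b" "t \<in> carrier G"
  shows "refl_parity a t = refl_parity b t"
proof -
  let ?t = "wp b \<otimes> t \<otimes> inv (wp b)"
  have conj: "inv (wp b) \<otimes> ?t \<otimes> inv (inv (wp b)) = t"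
    using assms conj_eq_iff[of t ?t "wp b"] by simp
  have "\<not> refl_parity (a @ rev b) ?t" "\<not> refl_parity (b @ rev b) ?t"
    using assms by (intro refl_parity_one; auto simp: wp_append wp_rev)+
  then show ?thesis using assms conj
    by (simp add: refl_parity_append wp_rev)
qed

text \<open>For \<open>t = g s g^-1\<close> and a word \<open>b\<close> of \<open>g\<close>, the
  palindrome \<open>b @ [s] @ rev b\<close> represents \<open>t\<close>. The contributions of
  \<open>b\<close> and \<open>rev b\<close> cancel, and the middle letter is left.\<close>

lemma refl_parity_reflection:
  assumes "t \<in> reflections G S" "c \<in> lists S" "wp c = t"
  shows "refl_parity c t"
proof -
  obtain g s where t: "t = g \<otimes> s \<otimes> inv g" "g \<in> carrier G" "s \<in> S"
    using assms by (auto simp: reflections_def)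
  obtain b where b: "b \<in> lists S" "wp b = g" using ex_word t by blast
  have tc: "t \<in> carrier G" using t by auto
  have conj: "inv g \<otimes> t \<otimes> inv (inv g) = s"
    using t by (simp add: m_assoc) (simp flip: m_assoc)
  have "\<not> refl_parity (b @ rev b) t"
    using b tc by (intro refl_parity_one; auto simp: wp_append wp_rev)
  then have 1: "refl_parity (rev b) t = refl_parity b s"
    using b t tc conj by (simp add: refl_parity_append wp_rev)
  have "s \<otimes> inv g \<otimes> t \<otimes> inv (s \<otimes> inv g) = s \<otimes> (inv g \<otimes> t \<otimes> inv (inv g)) \<otimes> s"
    using t(2,3) tc by (simp add: inv_mult_group m_assoc)
  then have conj': "s \<otimes> inv g \<otimes> t \<otimes> inv (s \<otimes> inv g) = s"
    using t(2,3) by (simp only: conj) simp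
  have "refl_parity (b @ [s] @ rev b) t"
    using b t(2,3) tc conj conj' 1 t(1)[symmetric] by (simp add: refl_parity_append wp_rev wp_append)
  moreover have "wp (b @ [s] @ rev b) = wp c"
    using b t assms by (simp add: wp_append wp_rev m_assoc)
  ultimately show ?thesis
    using refl_parity_cong[of "b @ [s] @ rev b" c t] b t assms tc by simp
qed

text \<open>An odd count is positive, so at least one letter has the required deletion
  effect.\<close>

lemma refl_parity_delete:
  assumes "a \<in> lists S" "refl_parity a t" "t \<in> carrier G"
  shows "\<exists>b s c. a = b @ s # c \<and> wp a \<otimes> t = wp (b @ c)"
  using assms(1,2)
proof (induction a)
  case (Cons s a)
  have c: "s \<in> S" "wp a \<in> carrier G" using Cons by auto
  show ?case
  proof (cases "refl_parity a t")
    case True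
    with Cons obtain b r c where "a = b @ r # c" "wp a \<otimes> t = wp (b @ c)" by auto
    then show ?thesis using c assms(3)
      by (intro exI[of _ "s # b"] exI[of _ r] exI[of _ c]) (simp add: m_assoc)
  next
    case False
    then have "wp a \<otimes> t \<otimes> inv (wp a) = s"
      using Cons c assms(3) conj_eq_iff[of t s "wp a"] by auto
    then have "wp a \<otimes> t = s \<otimes> wp a"
      using c assms(3) by (metis S_closed inv_closed inv_solve_right m_closed)
    then show ?thesis using c assms(3)
      by (intro exI[of _ "[]"] exI[of _ s] exI[of _ a]) (simp add: m_assoc)
  qed
qed simp

text \<open>If the parity of \<open>a\<close> at \<open>t\<close> were even, appending a word for
  \<open>t\<close> would make it odd. A reduced word of \<open>wp a t\<close> would then have odd
  parity too, and deleting a letter from it would give too short a word for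
  \<open>wp a\<close>.\<close>

theorem strong_exchange:
  assumes a: "a \<in> lists S" and t: "t \<in> reflections G S" and less: "len (wp a \<otimes> t) < len (wp a)"
  obtains b s c where "a = b @ s # c" "wp a \<otimes> t = wp (b @ c)"
proof -
  have tc: "t \<in> carrier G" using t by (rule reflection_closed)
  have tt: "t \<otimes> t = \<one>" using t by (rule reflection_square)
  have wtt: "wp a \<otimes> t \<otimes> t = wp a" using a tc tt by (simp add: m_assoc)
  obtain c where c: "c \<in> lists S" "wp c = t" using ex_word tc by blast
  have "refl_parity a t"
  proof (rule ccontr)
    assume "\<not> refl_parity a t"
    moreover have "t \<otimes> t \<otimes> inv t = t" using tc by (simp add: m_assoc)
    ultimately have 1: "refl_parity (a @ c) t"
      using a c tc refl_parity_reflection[OF t c] by (simp add: refl_parity_append)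
    have ac: "wp (a @ c) = wp a \<otimes> t" "a @ c \<in> lists S" using a c by (simp_all add: wp_append)
    obtain d where d: "d \<in> lists S" "wp d = wp a \<otimes> t" "length d = len (wp a \<otimes> t)"
      using ex_reduced[of "wp a \<otimes> t"] a tc by auto
    have "refl_parity d t" using 1 refl_parity_cong[of "a @ c" d t] ac d tc by simp
    then obtain e r f where e: "d = e @ r # f" "wp d \<otimes> t = wp (e @ f)"
      using refl_parity_delete d tc by blast
    then have "len (wp a) \<le> length (e @ f)" using d wtt len_le[of "e @ f"] by auto
    then show False using e d less by simp
  qed
  then show ?thesis using refl_parity_delete[OF a _ tc] that by blast
qed

lemma S_reflection: "s \<in> S \<Longrightarrow> s \<in> reflections G S"
  unfolding reflections_def by (force intro!: exI[of _ \<one>] exI[of _ s])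

lemma reflection_conj:
  assumes "t \<in> reflections G S" "s \<in> S"
  shows "s \<otimes> t \<otimes> s \<in> reflections G S"
proof -
  obtain g r where "t = g \<otimes> r \<otimes> inv g" "g \<in> carrier G" "r \<in> S"
    using assms by (auto simp: reflections_def)
  then have "s \<otimes> t \<otimes> s = (s \<otimes> g) \<otimes> r \<otimes> inv (s \<otimes> g)" "s \<otimes> g \<in> carrier G" "r \<in> S"
    using assms by (simp_all add: inv_mult_group m_assoc)
  then show ?thesis unfolding reflections_def by blast
qed

lemma odd_len_reflection: "t \<in> reflections G S \<Longrightarrow> odd (len t)"
  by (auto simp: reflections_def even_len_mult len_inv)

section \<open>Bruhat order\<close>

definition edge :: "'a \<Rightarrow> 'a \<Rightarrow> bool" where
  "edge x y \<longleftrightarrow> x \<in> carrier G \<and> (\<exists>t \<in> reflections G S. y = x \<otimes> t) \<and> len x < len y"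

lemma edge_closed: "edge x y \<Longrightarrow> x \<in> carrier G \<and> y \<in> carrier G"
  by (auto simp: edge_def intro: reflection_closed)

lemma bruhat_le_iff: "bruhat_le G S x y \<longleftrightarrow> x \<in> carrier G \<and> edge\<^sup>*\<^sup>* x y"
proof -
  have "{(x, x \<otimes> t) | x t. x \<in> carrier G \<and> t \<in> reflections G S \<and> len x < len (x \<otimes> t)}
      = {(x, y). edge x y}"
    by (auto simp: edge_def)
  moreover have "edge\<^sup>*\<^sup>* x y \<Longrightarrow> x \<in> carrier G \<Longrightarrow> y \<in> carrier G"
    by (induction rule: rtranclp_induct) (auto dest: edge_closed)
  ultimately show ?thesis
    by (auto simp: bruhat_le_def rtranclp_rtrancl_eq)
qed

lemma bruhat_refl: "x \<in> carrier G \<Longrightarrow> bruhat_le G S x x"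
  by (simp add: bruhat_le_iff)

lemma bruhat_trans: "bruhat_le G S x y \<Longrightarrow> bruhat_le G S y z \<Longrightarrow> bruhat_le G S x z"
  by (auto simp: bruhat_le_iff)

lemma bruhat_edge: "edge x y \<Longrightarrow> bruhat_le G S x y"
  by (auto simp: bruhat_le_iff dest: edge_closed)

lemma bruhat_closed: "bruhat_le G S x y \<Longrightarrow> x \<in> carrier G \<and> y \<in> carrier G"
  by (simp add: bruhat_le_def)

lemma bruhat_len: "bruhat_le G S x y \<Longrightarrow> x = y \<or> len x < len y"
proof -
  have "edge\<^sup>*\<^sup>* x y \<Longrightarrow> x = y \<or> len x < len y"
    by (induction rule: rtranclp_induct) (auto simp: edge_def)
  then show "bruhat_le G S x y \<Longrightarrow> x = y \<or> len x < len y" by (simp add: bruhat_le_iff)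
qed

lemma bruhat_up: "x \<in> carrier G \<Longrightarrow> s \<in> S \<Longrightarrow> len x < len (x \<otimes> s) \<Longrightarrow> bruhat_le G S x (x \<otimes> s)"
  by (intro bruhat_edge) (auto simp: edge_def S_reflection)

lemma bruhat_down: "x \<in> carrier G \<Longrightarrow> s \<in> S \<Longrightarrow> len (x \<otimes> s) < len x \<Longrightarrow> bruhat_le G S (x \<otimes> s) x"
  using bruhat_up[of "x \<otimes> s" s] by simp

text \<open>The lengths of \<open>xs\<close> and \<open>ys\<close> differ by parity. If they came in
  the wrong order, strong exchange in a reduced word of \<open>y\<close> ending in \<open>s\<close>
  would leave only \<open>xs = y\<close>.\<close>

lemma edge_mult:
  assumes "edge x y" "s \<in> S"
  shows "x \<otimes> s = y \<or> edge (x \<otimes> s) (y \<otimes> s)"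
proof -
  obtain t where t: "t \<in> reflections G S" "y = x \<otimes> t" and less: "len x < len y"
    and x: "x \<in> carrier G" using assms by (auto simp: edge_def)
  have c: "t \<in> carrier G" "y \<in> carrier G" using t x by (auto intro: reflection_closed)
  have tt: "t \<otimes> t = \<one>" using t(1) by (rule reflection_square)
  have ys: "y \<otimes> s = (x \<otimes> s) \<otimes> (s \<otimes> t \<otimes> s)" using assms x t c by (simp add: m_assoc)
  have yt: "y \<otimes> t = x" using x c t tt by (simp add: m_assoc)
  have "odd (len (s \<otimes> t \<otimes> s))" by (intro odd_len_reflection reflection_conj t assms)
  then have ne: "len (x \<otimes> s) \<noteq> len (y \<otimes> s)"
    using even_len_mult[of "x \<otimes> s" "s \<otimes> t \<otimes> s"] ys x c assms by auto
  show ?thesis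
  proof (cases "len (x \<otimes> s) < len (y \<otimes> s)")
    case True
    then have "edge (x \<otimes> s) (y \<otimes> s)"
      using ys reflection_conj[OF t(1) assms(2)] x assms unfolding edge_def by auto
    then show ?thesis ..
  next
    case False
    \<comment> \<open>Since \<open>x\<close> is shorter than \<open>y\<close>, the order can only be
      reversed if \<open>s\<close> lengthens \<open>x\<close> and shortens \<open>y\<close>.\<close>
    have xs: "len (x \<otimes> s) = Suc (len x)" and y: "len y = Suc (len (y \<otimes> s))"
      using ne False len_mult_S[OF x assms(2)] len_mult_S[OF c(2) assms(2)] less by auto
    obtain a where a: "a \<in> lists S" "wp a = y \<otimes> s" "length a = len (y \<otimes> s)"
      using ex_reduced[of "y \<otimes> s"] c assms by auto
    have as: "a @ [s] \<in> lists S" "wp (a @ [s]) = y" using a c assms by (auto simp: wp_append)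
    have "len (wp (a @ [s]) \<otimes> t) < len (wp (a @ [s]))" using as less yt by simp
    from strong_exchange[OF as(1) t(1) this]
    obtain b r d where b: "a @ [s] = b @ r # d" "x = wp (b @ d)" using as yt by metis
    show ?thesis
    proof (cases d rule: rev_cases)
      case Nil
      then have "x = y \<otimes> s" using a b by auto
      then show ?thesis using c assms by simp
    next
      case (snoc e r')
      \<comment> \<open>The deleted letter lies before the final \<open>s\<close>, so removing that
        \<open>s\<close> as well makes \<open>xs\<close> shorter than \<open>ys\<close>, contrary to
        the case assumption.\<close>
      then have e: "a = b @ r # e" "r' = s" using b by auto
      then have "x \<otimes> s = wp (b @ e)" using b a snoc assms by (auto simp: wp_append m_assoc)
      then have "len (x \<otimes> s) \<le> length (b @ e)" using a e len_le[of "b @ e"] by auto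
      then show ?thesis using xs less y a e False by simp
    qed
  qed
qed

text \<open>Multiplication by \<open>s\<close> is pushed up a chain edge by edge; where
  \<open>edge_mult\<close> yields no new edge, \<open>ys\<close> is already the next vertex, and the
  second alternative persists from there.\<close>

lemma bruhat_mult_up:
  assumes "bruhat_le G S x y" "s \<in> S"
  shows "bruhat_le G S (x \<otimes> s) (y \<otimes> s) \<or> bruhat_le G S (x \<otimes> s) y"
proof -
  have x: "x \<in> carrier G" and xy: "edge\<^sup>*\<^sup>* x y" using assms by (auto simp: bruhat_le_iff)
  from xy show ?thesis
  proof (induction rule: rtranclp_induct)
    case base
    then show ?case using x assms by (auto intro: bruhat_refl)
  next
    case (step y z)
    from step.IH show ?case
    proof
      assume 1: "bruhat_le G S (x \<otimes> s) (y \<otimes> s)"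
      from edge_mult[OF step.hyps(2) assms(2)] show ?thesis
        using 1 by (auto intro: bruhat_trans bruhat_edge)
    next
      assume "bruhat_le G S (x \<otimes> s) y"
      then show ?thesis using step.hyps(2) by (blast intro: bruhat_trans bruhat_edge)
    qed
  qed
qed

lemma bruhat_mult_down:
  assumes "bruhat_le G S x y" "s \<in> S"
  shows "bruhat_le G S (x \<otimes> s) (y \<otimes> s) \<or> bruhat_le G S x (y \<otimes> s)"
proof -
  have y: "y \<in> carrier G" using assms bruhat_closed by blast
  have xy: "edge\<^sup>*\<^sup>* x y" using assms by (auto simp: bruhat_le_iff)
  from xy show ?thesis
  proof (induction rule: converse_rtranclp_induct)
    case base
    then show ?case using y assms by (auto intro: bruhat_refl)
  next
    case (step x z)
    from step.IH show ?case
    proof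
      assume 1: "bruhat_le G S (z \<otimes> s) (y \<otimes> s)"
      from edge_mult[OF step.hyps(1) assms(2)] show ?thesis
      proof
        assume "x \<otimes> s = z"
        then have "z \<otimes> s = x" using assms edge_closed[OF step.hyps(1)] by auto
        then show ?thesis using 1 by simp
      qed (use 1 in \<open>blast intro: bruhat_trans bruhat_edge\<close>)
    next
      assume "bruhat_le G S z (y \<otimes> s)"
      then show ?thesis using step.hyps(1) by (blast intro: bruhat_trans bruhat_edge)
    qed
  qed
qed

text \<open>Together with the next two lemmas this is the lifting property: the sign of
  \<open>s\<close> on one argument merges the two alternatives of the preceding lemmas.\<close>

lemma lifting_up:
  assumes "bruhat_le G S x y" "s \<in> S" "len y < len (y \<otimes> s)"
  shows "bruhat_le G S (x \<otimes> s) (y \<otimes> s)"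
  using bruhat_mult_up[OF assms(1,2)] bruhat_up[of y s] assms bruhat_closed bruhat_trans by blast

lemma lifting_down:
  assumes "bruhat_le G S u w" "s \<in> S" "len u < len (u \<otimes> s)"
  shows "bruhat_le G S u (w \<otimes> s)"
  using bruhat_mult_down[OF assms(1,2)] bruhat_up[of u s] assms bruhat_closed bruhat_trans by blast

lemma lifting_both:
  assumes "bruhat_le G S u w" "s \<in> S" "len (u \<otimes> s) < len u"
  shows "bruhat_le G S (u \<otimes> s) (w \<otimes> s)"
  using bruhat_mult_down[OF assms(1,2)] bruhat_down[of u s] assms bruhat_closed bruhat_trans by blast

section \<open>Hecke operators\<close>

text \<open>Exchange deletes a letter from \<open>s # a\<close> to reach \<open>svt\<close>.
  Deleting \<open>s\<close> itself gives \<open>svt = v\<close>, which is the claim; deleting a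
  letter of \<open>a\<close> would make \<open>vt\<close> shorter than \<open>v\<close>.\<close>

lemma left_right_fold:
  assumes "v \<in> carrier G" "s \<in> S" "t \<in> S"
    and "len v < len (s \<otimes> v)" "len v < len (v \<otimes> t)" "len (s \<otimes> v \<otimes> t) < len (s \<otimes> v)"
  shows "s \<otimes> v = v \<otimes> t"
proof -
  obtain a where a: "a \<in> lists S" "wp a = v" "length a = len v" using ex_reduced assms(1) .
  have sa: "s # a \<in> lists S" "wp (s # a) = s \<otimes> v" using a assms by auto
  have "len (wp (s # a) \<otimes> t) < len (wp (s # a))" using assms sa by simp
  from strong_exchange[OF sa(1) S_reflection[OF assms(3)] this]
  obtain b r c where b: "s # a = b @ r # c" "s \<otimes> v \<otimes> t = wp (b @ c)" using sa by metis
  show ?thesis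
  proof (cases b)
    case Nil
    then have "s \<otimes> v \<otimes> t = v" using b a by simp
    then show ?thesis using assms by (metis S_cancel_right S_closed m_closed)
  next
    case (Cons s' b')
    then have a': "s' = s" "a = b' @ r # c" using b by auto
    have bc: "b' @ c \<in> lists S" using a a' by auto
    then have "s \<otimes> (v \<otimes> t) = s \<otimes> wp (b' @ c)" using b Cons a' assms by (simp add: m_assoc)
    then have "v \<otimes> t = wp (b' @ c)" using assms bc by simp
    then show ?thesis using len_le[OF bc] a a' assms by simp
  qed
qed

text \<open>Away from the coincidence \<open>su = ut\<close>, multiplication on one side does not
  affect descents on the other. This follows by applying \<open>left_right_fold\<close> at each
  corner of the square \<open>u\<close>, \<open>su\<close>, \<open>ut\<close>,
  \<open>sut\<close>.\<close>

lemma left_right_descents: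
  assumes u: "u \<in> carrier G" and s: "s \<in> S" and t: "t \<in> S" and ne: "s \<otimes> u \<noteq> u \<otimes> t"
  shows "len (s \<otimes> (u \<otimes> t)) < len (u \<otimes> t) \<longleftrightarrow> len (s \<otimes> u) < len u"
    and "len (s \<otimes> (u \<otimes> t)) < len (s \<otimes> u) \<longleftrightarrow> len (u \<otimes> t) < len u"
proof -
  have c: "s \<in> carrier G" "t \<in> carrier G" using s t by auto
  have e1: "\<not> (len v < len (s \<otimes> v) \<and> len v < len (v \<otimes> t) \<and> len (s \<otimes> (v \<otimes> t)) < len (s \<otimes> v))"
    if "v \<in> carrier G" "s \<otimes> v \<noteq> v \<otimes> t" for v
    using left_right_fold[OF that(1) s t] that c by (auto simp: m_assoc)
  have n: "s \<otimes> (u \<otimes> t) \<noteq> u"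
  proof
    assume "s \<otimes> (u \<otimes> t) = u"
    then have "s \<otimes> (s \<otimes> (u \<otimes> t)) = s \<otimes> u" by simp
    then show False using ne u s t by simp
  qed
  have n1: "s \<otimes> (s \<otimes> u) \<noteq> s \<otimes> u \<otimes> t" using n u s t by (auto simp: m_assoc)
  have n2: "s \<otimes> (u \<otimes> t) \<noteq> u \<otimes> t \<otimes> t" using n u s t by auto
  have n3: "s \<otimes> (s \<otimes> (u \<otimes> t)) \<noteq> s \<otimes> (u \<otimes> t) \<otimes> t"
    using ne u s t by (auto simp: m_assoc)
  have L: "len (u \<otimes> t) = Suc (len u) \<or> len u = Suc (len (u \<otimes> t))"
    "len (s \<otimes> u) = Suc (len u) \<or> len u = Suc (len (s \<otimes> u))"
    "len (s \<otimes> (u \<otimes> t)) = Suc (len (u \<otimes> t)) \<or> len (u \<otimes> t) = Suc (len (s \<otimes> (u \<otimes> t)))"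
    "len (s \<otimes> (u \<otimes> t)) = Suc (len (s \<otimes> u)) \<or> len (s \<otimes> u) = Suc (len (s \<otimes> (u \<otimes> t)))"
    using len_mult_S[OF u t] len_S_mult[OF u s] len_S_mult[of "u \<otimes> t" s] len_mult_S[of "s \<otimes> u" t]
      u s t c by (simp_all add: m_assoc)
  have E1: "\<not> (len u < len (s \<otimes> u) \<and> len u < len (u \<otimes> t) \<and> len (s \<otimes> (u \<otimes> t)) < len (s \<otimes> u))"
    using e1[OF u ne] .
  have E2: "\<not> (len (s \<otimes> u) < len u \<and> len (s \<otimes> u) < len (s \<otimes> (u \<otimes> t)) \<and> len (u \<otimes> t) < len u)"
    using e1[OF _ n1] u s t by (simp add: m_assoc)
  have E3: "\<not> (len (u \<otimes> t) < len (s \<otimes> (u \<otimes> t)) \<and> len (u \<otimes> t) < len u \<and> len (s \<otimes> u) < len (s \<otimes> (u \<otimes> t)))"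
    using e1[OF _ n2] u s t by (simp add: m_assoc)
  have E4: "\<not> (len (s \<otimes> (u \<otimes> t)) < len (u \<otimes> t) \<and> len (s \<otimes> (u \<otimes> t)) < len (s \<otimes> u) \<and> len u < len (u \<otimes> t))"
    using e1[OF _ n3] u s t by (simp add: m_assoc)
  show "len (s \<otimes> (u \<otimes> t)) < len (u \<otimes> t) \<longleftrightarrow> len (s \<otimes> u) < len u"
    using L E1 E2 E3 E4 by linarith
  show "len (s \<otimes> (u \<otimes> t)) < len (s \<otimes> u) \<longleftrightarrow> len (u \<otimes> t) < len u"
    using L E1 E2 E3 E4 by linarith
qed

section \<open>Commuting left and right operators on functions\<close>

definition delta :: "'a \<Rightarrow> 'a \<Rightarrow> int poly" where
  "delta x u = (if u = x then 1 else 0)"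

text \<open>
  Functions on the group stand for elements of a Hecke module. \<open>right_T t\<close> is right
  multiplication by a generator with quadratic relation \<open>T\<^sup>2 = (1 - q) T + q\<close>, and
  \<open>right_R t = right_T t + (q - 1)\<close> is \<open>q\<close> times its inverse; the latter is the recursion
  step for the R-polynomials in the first argument.
\<close>

definition right_T :: "'a \<Rightarrow> ('a \<Rightarrow> int poly) \<Rightarrow> 'a \<Rightarrow> int poly" where
  "right_T t f u = (if u \<notin> carrier G then 0
     else if len (u \<otimes> t) < len u then f (u \<otimes> t) + [:1, -1:] * f u
     else [:0, 1:] * f (u \<otimes> t))"

definition right_R :: "'a \<Rightarrow> ('a \<Rightarrow> int poly) \<Rightarrow> 'a \<Rightarrow> int poly" where
  "right_R t f u = (if u \<notin> carrier G then 0
     else if len (u \<otimes> t) < len u then f (u \<otimes> t)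
     else [:-1, 1:] * f u + [:0, 1:] * f (u \<otimes> t))"

definition left_R :: "'a \<Rightarrow> ('a \<Rightarrow> int poly) \<Rightarrow> 'a \<Rightarrow> int poly" where
  "left_R s f u = (if u \<notin> carrier G then 0
     else if len (s \<otimes> u) < len u then f (s \<otimes> u)
     else [:-1, 1:] * f u + [:0, 1:] * f (s \<otimes> u))"

lemma right_left_commute:
  assumes s: "s \<in> S" and t: "t \<in> S"
  shows "right_T t (left_R s f) = left_R s (right_T t f)"
    and "right_R t (left_R s f) = left_R s (right_R t f)"
proof -
  have "right_T t (left_R s f) u = left_R s (right_T t f) u \<and>
      right_R t (left_R s f) u = left_R s (right_R t f) u" for u
  proof (cases "u \<in> carrier G")
    case u: True
    have sut: "s \<otimes> u \<otimes> t = s \<otimes> (u \<otimes> t)" "s \<otimes> u \<in> carrier G" "u \<otimes> t \<in> carrier G"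
      using u s t by (auto simp: m_assoc)
    show ?thesis
    proof (cases "s \<otimes> u = u \<otimes> t")
      \<comment> \<open>Here left multiplication by \<open>s\<close> and right multiplication by
        \<open>t\<close> both swap \<open>u\<close> and \<open>ut\<close>, so
        \<open>left_R s\<close> and \<open>right_R t\<close> agree on this pair.\<close>
      case True
      have eq: "s \<otimes> (u \<otimes> t) = u" using u s by (simp flip: True)
      have eq': "u \<otimes> t \<otimes> t = u" using u t by simp
      consider "len (u \<otimes> t) < len u" "\<not> len u < len (u \<otimes> t)"
        | "len u < len (u \<otimes> t)" "\<not> len (u \<otimes> t) < len u"
        using len_mult_S[OF u t] by fastforce
      then show ?thesis
        using u sut eq eq'
        by cases (simp_all add: right_T_def right_R_def left_R_def True algebra_simps)
    next
      case False
      note D = left_right_descents[OF u s t False]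
      show ?thesis
        using u sut D
        by (cases "len (s \<otimes> u) < len u"; cases "len (u \<otimes> t) < len u")
          (simp_all add: right_T_def right_R_def left_R_def algebra_simps)
    qed
  qed (simp add: right_T_def right_R_def left_R_def)
  then show "right_T t (left_R s f) = left_R s (right_T t f)"
    and "right_R t (left_R s f) = left_R s (right_R t f)" by auto
qed

text \<open>The operators return 0 outside the carrier, so the inverse relations are stated for
  functions that vanish there.\<close>

definition supported :: "('a \<Rightarrow> int poly) \<Rightarrow> bool" where
  "supported f \<longleftrightarrow> (\<forall>u. u \<notin> carrier G \<longrightarrow> f u = 0)"

lemma right_T_R:
  assumes t: "t \<in> S" and f: "supported f"
  shows "right_T t (right_R t f) = (\<lambda>u. [:0, 1:] * f u)"
    and "right_R t (right_T t f) = (\<lambda>u. [:0, 1:] * f u)"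
proof -
  have "right_T t (right_R t f) u = [:0, 1:] * f u \<and> right_R t (right_T t f) u = [:0, 1:] * f u" for u
  proof (cases "u \<in> carrier G")
    case u: True
    have eq: "u \<otimes> t \<otimes> t = u" "u \<otimes> t \<in> carrier G" using u t by auto
    consider "len (u \<otimes> t) < len u" "\<not> len u < len (u \<otimes> t)"
      | "len u < len (u \<otimes> t)" "\<not> len (u \<otimes> t) < len u"
      using len_mult_S[OF u t] by fastforce
    then show ?thesis
      using u eq by cases (simp_all add: right_T_def right_R_def algebra_simps)
  qed (use f in \<open>simp add: right_T_def right_R_def supported_def\<close>)
  then show "right_T t (right_R t f) = (\<lambda>u. [:0, 1:] * f u)"
    and "right_R t (right_T t f) = (\<lambda>u. [:0, 1:] * f u)" by auto
qed

lemma supported_ops [simp]: "supported (right_T t f)" "supported (right_R t f)"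
  by (auto simp: supported_def right_T_def right_R_def)

lemma supported_delta [simp]: "x \<in> carrier G \<Longrightarrow> supported (delta x)"
  by (auto simp: supported_def delta_def)

lemma supported_fold [simp]:
  "supported f \<Longrightarrow> supported (fold right_R a f)" "supported f \<Longrightarrow> supported (fold right_T a f)"
  by (induction a arbitrary: f) auto

lemma scale_ops:
  "right_T t (\<lambda>u. c * f u) = (\<lambda>u. c * right_T t f u)"
  "right_R t (\<lambda>u. c * f u) = (\<lambda>u. c * right_R t f u)"
  by (auto simp: right_T_def right_R_def algebra_simps)

lemma scale_fold_R:
  "fold right_R a (\<lambda>u. c * f u) = (\<lambda>u. c * fold right_R a f u)"
  by (induction a arbitrary: f) (simp_all add: scale_ops)

text \<open>The reversed word undoes the last letter first; each inner pair cancels to a factor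
  \<open>q\<close>, which commutes with the remaining operators.\<close>

lemma fold_T_rev_R:
  assumes "a \<in> lists S" "supported f"
  shows "fold right_T (rev a) (fold right_R a f) = (\<lambda>u. [:0, 1:] ^ length a * f u)"
  using assms
proof (induction a arbitrary: f)
  case (Cons s a)
  then show ?case by (simp add: right_T_R scale_ops mult.assoc mult.left_commute)
qed simp

lemma fold_R_rev_T:
  assumes "a \<in> lists S" "supported f"
  shows "fold right_R a (fold right_T (rev a) f) = (\<lambda>u. [:0, 1:] ^ length a * f u)"
  using assms(1)
proof (induction a)
  case (Cons s a)
  let ?g = "fold right_T (rev a) f"
  have "fold right_R (s # a) (fold right_T (rev (s # a)) f)
      = fold right_R a (right_R s (right_T s ?g))" by simp
  also have "right_R s (right_T s ?g) = (\<lambda>u. [:0, 1:] * ?g u)"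
    using Cons.hyps assms(2) by (simp only: right_T_R supported_fold)
  also have "fold right_R a (\<lambda>u. [:0, 1:] * ?g u) = (\<lambda>u. [:0, 1:] * fold right_R a ?g u)"
    by (rule scale_fold_R)
  finally show ?case using Cons by (simp add: mult.assoc)
qed simp

lemma right_T_delta:
  assumes "x \<in> carrier G" "s \<in> S" "len x < len (x \<otimes> s)"
  shows "right_T s (delta x) = delta (x \<otimes> s)"
proof
  fix u
  show "right_T s (delta x) u = delta (x \<otimes> s) u"
  proof (cases "u \<in> carrier G")
    case True
    then have "u \<otimes> s = x \<longleftrightarrow> u = x \<otimes> s" using assms by auto
    then show ?thesis using True assms by (auto simp: right_T_def delta_def)
  qed (use assms in \<open>auto simp: right_T_def delta_def\<close>)
qed

text \<open>Every prefix of a reduced word is reduced, so each letter raises the length and moves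
  the delta function by \<open>right_T_delta\<close>.\<close>

lemma fold_right_T_delta:
  assumes "a \<in> lists S" "len (wp a) = length a"
  shows "fold right_T a (delta \<one>) = delta (wp a)"
  using assms
proof (induction a rule: rev_induct)
  case (snoc s a)
  then have a: "a \<in> lists S" "s \<in> S" "wp (a @ [s]) = wp a \<otimes> s" by (auto simp: wp_append)
  have "len (wp a) \<le> length a" using a by (simp add: len_le)
  then have "len (wp a) = length a" "len (wp a) < len (wp a \<otimes> s)"
    using len_mult_S[of "wp a" s] a snoc.prems by auto
  then show ?case using snoc.IH a right_T_delta[of "wp a" s] by simp
qed simp

lemma right_R_delta_one: "s \<in> S \<Longrightarrow> right_R s (delta \<one>) = left_R s (delta \<one>)"
proof
  fix u assume s: "s \<in> S"
  show "right_R s (delta \<one>) u = left_R s (delta \<one>) u"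
  proof (cases "u \<in> carrier G")
    case u: True
    have "u \<otimes> s = \<one> \<longleftrightarrow> u = s" "s \<otimes> u = \<one> \<longleftrightarrow> u = s"
      using u s by (metis S_closed S_inv inv_equality inv_inv S_square)+
    then show ?thesis using u s by (auto simp: right_R_def left_R_def delta_def)
  qed (simp add: right_R_def left_R_def)
qed

lemma fold_right_left:
  assumes "a \<in> lists S" "s \<in> S"
  shows "fold right_T a (left_R s f) = left_R s (fold right_T a f)"
    and "fold right_R a (left_R s f) = left_R s (fold right_R a f)"
  using assms by (induction a arbitrary: f) (auto simp: right_left_commute)

text \<open>On the delta function at the identity the first right operator equals the left one,
  which is then moved outside the remaining right operators; repeating this converts all
  letters.\<close>

lemma fold_right_R_eq_left: "a \<in> lists S \<Longrightarrow> fold right_R a (delta \<one>) = foldr left_R a (delta \<one>)"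
  by (induction a) (auto simp: right_R_delta_one fold_right_left)

lemma fold_right_T_foldr_left:
  assumes "a \<in> lists S" "b \<in> lists S"
  shows "fold right_T a (foldr left_R b f) = foldr left_R b (fold right_T a f)"
  using assms(2) by (induction b) (use assms(1) in \<open>auto simp: fold_right_left\<close>)

text \<open>
  On \<open>fold right_R b \<delta>\<^sub>1\<close>, which is also a product of left operators applied to \<open>\<delta>\<^sub>1\<close>, the
  operator \<open>fold right_T (rev a)\<close> depends only on the element that \<open>a\<close> represents.
\<close>

lemma fold_right_R_cong:
  assumes a: "a \<in> lists S" "len (wp a) = length a" and b: "b \<in> lists S" "len (wp b) = length b"
    and eq: "wp a = wp b"
  shows "fold right_R a (delta \<one>) = fold right_R b (delta \<one>)"
proof -
  let ?d = "delta \<one>" and ?A = "fold right_R a (delta \<one>)" and ?B = "fold right_R b (delta \<one>)"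
  have T_rev: "fold right_T (rev c) ?d = delta (inv (wp c))"
    if "c \<in> lists S" "len (wp c) = length c" for c
    using fold_right_T_delta[of "rev c"] that by (simp add: wp_rev len_inv)
  have "fold right_T (rev a) ?B = foldr left_R b (fold right_T (rev a) ?d)"
    using a b by (simp add: fold_right_R_eq_left fold_right_T_foldr_left)
  also have "\<dots> = fold right_T (rev b) ?B"
    using a b eq by (simp add: fold_right_R_eq_left fold_right_T_foldr_left T_rev)
  also have "\<dots> = fold right_T (rev a) ?A"
    using a b eq by (simp add: fold_T_rev_R)
  \<comment> \<open>Applying \<open>fold right_R a\<close> inverts
    \<open>fold right_T (rev a)\<close> up to a power of \<open>q\<close>, which cancels because
    integer polynomials form a domain.\<close>
  finally have "fold right_R a (fold right_T (rev a) ?B) = fold right_R a (fold right_T (rev a) ?A)"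
    by simp
  then have "(\<lambda>u. [:0, 1:] ^ length a * ?B u) = (\<lambda>u. [:0, 1:] ^ length a * ?A u)"
    using a by (simp add: fold_R_rev_T)
  then show ?thesis by (auto simp: fun_eq_iff)
qed

section \<open>The family of R-polynomials\<close>

definition reduced_word :: "'a \<Rightarrow> 'a list" where
  "reduced_word w = (SOME a. a \<in> lists S \<and> wp a = w \<and> length a = len w)"

lemma reduced_word:
  "w \<in> carrier G \<Longrightarrow>
    reduced_word w \<in> lists S \<and> wp (reduced_word w) = w \<and> length (reduced_word w) = len w"
  unfolding reduced_word_def by (rule someI_ex) (metis ex_reduced)

text \<open>The existence witness: one operator per letter, starting from the delta function at the
  identity. The choice of reduced word is immaterial by \<open>fold_right_R_cong\<close>.\<close>

definition R_fun :: "'a \<Rightarrow> 'a \<Rightarrow> int poly" where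
  "R_fun u w = (if w \<in> carrier G then fold right_R (reduced_word w) (delta \<one>) u else 0)"

text \<open>A reduced word of \<open>ws\<close> followed by \<open>s\<close> is a reduced word of
  \<open>w\<close>, so it may replace the chosen one.\<close>

lemma R_fun_step:
  assumes "w \<in> carrier G" "s \<in> S" "len (w \<otimes> s) < len w"
  shows "R_fun u w = right_R s (\<lambda>u. R_fun u (w \<otimes> s)) u"
proof -
  let ?a = "reduced_word (w \<otimes> s)"
  have a: "?a \<in> lists S" "wp ?a = w \<otimes> s" "length ?a = len (w \<otimes> s)"
    using reduced_word[of "w \<otimes> s"] assms by auto
  have "len w = Suc (len (w \<otimes> s))" using len_mult_S[of w s] assms by auto
  then have "fold right_R (reduced_word w) (delta \<one>) = fold right_R (?a @ [s]) (delta \<one>)"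
    using reduced_word[OF assms(1)] a assms by (intro fold_right_R_cong) (auto simp: wp_append)
  then show ?thesis using assms by (simp add: R_fun_def)
qed

lemma R_fun_one: "R_fun u \<one> = delta \<one> u"
  using reduced_word[of \<one>] by (simp add: R_fun_def)

lemma descent_induct [consumes 1, case_names one step]:
  assumes "w \<in> carrier G" "P \<one>"
    and step: "\<And>w s. \<lbrakk>w \<in> carrier G; s \<in> S; len (w \<otimes> s) < len w; P (w \<otimes> s)\<rbrakk> \<Longrightarrow> P w"
  shows "P w"
  using assms(1)
proof (induction "len w" arbitrary: w rule: less_induct)
  case less
  show ?case
  proof (cases "w = \<one>")
    case False
    with less.prems obtain s where s: "s \<in> S" "len (w \<otimes> s) < len w" by (rule ex_right_descent)
    then have "P (w \<otimes> s)" using less by auto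
    then show ?thesis using s less.prems step by blast
  qed (simp add: assms(2))
qed

text \<open>Some term of the recursion must be nonzero. If \<open>s\<close> shortens
  \<open>u\<close>, lifting takes \<open>us <= ws\<close> to \<open>u <= w\<close>; otherwise
  \<open>u\<close> or \<open>us\<close> lies below \<open>ws\<close>, and transitivity
  suffices.\<close>

lemma R_fun_nonzero:
  assumes "w \<in> carrier G" "R_fun u w \<noteq> 0"
  shows "bruhat_le G S u w"
  using assms
proof (induction w arbitrary: u rule: descent_induct)
  case one
  then have "u = \<one>" by (auto simp: R_fun_one delta_def split: if_splits)
  then show ?case by (simp add: bruhat_refl)
next
  case (step w s)
  have ne: "right_R s (\<lambda>u. R_fun u (w \<otimes> s)) u \<noteq> 0"
    using step.prems step.hyps by (simp flip: R_fun_step)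
  then have u: "u \<in> carrier G" by (auto simp: right_R_def split: if_splits)
  have ww: "w \<otimes> s \<otimes> s = w" and down: "bruhat_le G S (w \<otimes> s) w"
    using step.hyps by (auto intro: bruhat_down)
  show ?case
  proof (cases "len (u \<otimes> s) < len u")
    case True
    then have "bruhat_le G S (u \<otimes> s) (w \<otimes> s)"
      using ne u step.IH[of "u \<otimes> s"] by (simp add: right_R_def)
    from lifting_up[OF this, of s] show ?thesis using step.hyps u ww by simp
  next
    case False
    then consider "R_fun u (w \<otimes> s) \<noteq> 0" | "R_fun (u \<otimes> s) (w \<otimes> s) \<noteq> 0"
      using ne u by (cases "R_fun u (w \<otimes> s) = 0") (auto simp: right_R_def)
    then show ?thesis
    proof cases
      case 1
      then show ?thesis using step.IH down bruhat_trans by blast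
    next
      case 2
      have "bruhat_le G S u (u \<otimes> s)"
        using False u step.hyps len_mult_S[of u s] by (intro bruhat_up) auto
      then show ?thesis using 2 step.IH down bruhat_trans by blast
    qed
  qed
qed

lemma R_fun_diag: "w \<in> carrier G \<Longrightarrow> R_fun w w = 1"
proof (induction w rule: descent_induct)
  case (step w s)
  then show ?case using R_fun_step[of w s w] by (simp add: right_R_def)
qed (simp add: R_fun_one delta_def)

lemma is_R_family_R_fun: "is_R_family G S R_fun"
  unfolding is_R_family_def
proof (intro conjI allI ballI impI)
  fix u w assume "\<not> bruhat_le G S u w"
  then show "R_fun u w = 0"
    using R_fun_nonzero[of w u] by (cases "w \<in> carrier G") (auto simp: R_fun_def)
qed (auto simp: R_fun_diag R_fun_step right_R_def)

text \<open>The recursion along descents of \<open>w\<close> leads back to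
  \<open>w = \<one>\<close>, where only \<open>u = \<one>\<close> gives a nonzero value.\<close>

lemma R_family_unique:
  assumes "is_R_family G S R" "is_R_family G S R'"
  shows "R = R'"
proof -
  have "R u w = R' u w" if "w \<in> carrier G" "u \<in> carrier G" for u w
    using that
  proof (induction w arbitrary: u rule: descent_induct)
    case one
    have "u = \<one> \<or> \<not> bruhat_le G S u \<one>" using bruhat_len[of u \<one>] by auto
    then show ?case using assms unfolding is_R_family_def by auto
  next
    case (step w s)
    have us: "u \<otimes> s \<in> carrier G" using step by auto
    have "len (u \<otimes> s) < len u \<or> len (u \<otimes> s) > len u"
      using len_mult_S[of u s] step by auto
    then show ?case
    proof
      assume "len (u \<otimes> s) < len u"
      then have "R u w = R (u \<otimes> s) (w \<otimes> s)" "R' u w = R' (u \<otimes> s) (w \<otimes> s)"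
        using assms step.hyps step.prems unfolding is_R_family_def by blast+
      then show ?thesis using step.IH us by simp
    next
      assume "len (u \<otimes> s) > len u"
      then have "R u w = [:-1, 1:] * R u (w \<otimes> s) + [:0, 1:] * R (u \<otimes> s) (w \<otimes> s)"
        "R' u w = [:-1, 1:] * R' u (w \<otimes> s) + [:0, 1:] * R' (u \<otimes> s) (w \<otimes> s)"
        using assms step.hyps step.prems unfolding is_R_family_def by blast+
      then show ?thesis using step.IH us step.prems by simp
    qed
  qed
  \<comment> \<open>The Bruhat relation fails outside the carrier, so both families vanish
    there.\<close>
  moreover have "R u w = R' u w" if "\<not> (w \<in> carrier G \<and> u \<in> carrier G)" for u w
    using assms that bruhat_closed unfolding is_R_family_def by metis
  ultimately show ?thesis by blast
qed

lemma is_R_family_R_poly: "is_R_family G S (R_poly G S)"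
  unfolding R_poly_def by (rule theI[of _ R_fun]) (auto intro: is_R_family_R_fun R_family_unique)

end

section \<open>Coefficientwise bounds\<close>

lemma coeffwise_le_refl: "p \<preceq>\<^sub>c p" and
  coeffwise_le_trans: "p \<preceq>\<^sub>c r \<Longrightarrow> r \<preceq>\<^sub>c r' \<Longrightarrow> p \<preceq>\<^sub>c r'"
  unfolding coeffwise_le_def by (auto intro: order.trans)

lemma coeffwise_le_add: "p \<preceq>\<^sub>c p' \<Longrightarrow> r \<preceq>\<^sub>c r' \<Longrightarrow> p + r \<preceq>\<^sub>c p' + r'"
  unfolding coeffwise_le_def by (auto intro: add_mono)

lemma coeffwise_le_mult_X: "p \<preceq>\<^sub>c r \<Longrightarrow> [:0, 1:] * p \<preceq>\<^sub>c [:0, 1:] * r"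
  unfolding coeffwise_le_def by (auto simp: coeff_pCons split: nat.split)

lemma coeffwise_le_mult_X1: "p \<preceq>\<^sub>c r \<Longrightarrow> [:1, 1:] * p \<preceq>\<^sub>c [:1, 1:] * r"
  unfolding coeffwise_le_def by (auto simp: coeff_pCons intro!: add_mono split: nat.split)

text \<open>Differentiation multiplies coefficients by nonnegative integers; this carries the bounds
  over to the derivatives.\<close>

lemma coeffwise_le_pderiv: "p \<preceq>\<^sub>c r \<Longrightarrow> pderiv p \<preceq>\<^sub>c pderiv r"
  unfolding coeffwise_le_def by (auto simp: coeff_pderiv intro!: mult_left_mono)

lemma X_power_nonneg: "0 \<preceq>\<^sub>c [:0, 1:] ^ n"
  by (induction n) (use coeffwise_le_mult_X[of 0] in \<open>auto simp: coeffwise_le_def\<close>)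

text \<open>Provides the upper bound for a vanishing term of the R-polynomial recursion.\<close>

lemma d_poly_nonneg: "0 \<preceq>\<^sub>c d_poly n"
proof (induction n rule: d_poly.induct)
  case (4 m)
  then show ?case
    using coeffwise_le_add[OF coeffwise_le_mult_X coeffwise_le_mult_X1, of 0 _ 0] by simp
qed (use X_power_nonneg[of 0] X_power_nonneg[of 1] X_power_nonneg[of 2] in auto)

text \<open>The recurrence has characteristic roots \<open>q + 1\<close> and \<open>-1\<close>. The
  formula is multiplied by \<open>q + 2\<close> to stay in the polynomial ring; it fails at
  \<open>n = 0\<close>, where the right side is 0.\<close>

lemma d_poly_closed_form:
  "n \<ge> 1 \<Longrightarrow> [:2, 1:] * d_poly n = [:0, 1:] * ([:1, 1:] ^ n - (- 1) ^ n)"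
proof (induction n rule: d_poly.induct)
  case (4 m)
  let ?q = "[:0, 1:] :: int poly" and ?p = "[:1, 1:] :: int poly"
  have "[:2, 1:] * d_poly (Suc (Suc (Suc m)))
      = ?q * ([:2, 1:] * d_poly (Suc (Suc m))) + ?p * ([:2, 1:] * d_poly (Suc m))"
    by (simp only: d_poly.simps algebra_simps)
  also have "\<dots> = ?q * (?q * (?p ^ Suc (Suc m) - (- 1) ^ Suc (Suc m)))
      + ?p * (?q * (?p ^ Suc m - (- 1) ^ Suc m))"
    using 4 by simp
  \<comment> \<open>Terms are grouped by characteristic root; the coefficients
    \<open>q + 1 = p\<close> and \<open>q - p = -1\<close> then raise each power by one.\<close>
  also have "\<dots> = ?q * ((?q + 1) * ?p ^ Suc (Suc m) - (?q - ?p) * (- 1) ^ Suc (Suc m))"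
    by (simp only: power_Suc) algebra
  also have "?q + 1 = ?p" by (simp add: one_pCons)
  also have "?q - ?p = - 1" by (simp add: one_pCons)
  finally show ?case by (simp only: power_Suc)
qed (simp_all add: power2_eq_square one_pCons)

lemma pderiv_linear_power:
  "pderiv ([:c, 1:] ^ n) = of_nat n * [:c, 1 :: int:] ^ (n - 1)"
  unfolding pderiv_power by (simp add: pderiv_pCons of_nat_poly)

section \<open>Closed forms in the fraction field\<close>

lemma to_fract_power: "to_fract (x ^ n) = to_fract x ^ n"
  by (induction n) simp_all

lemma to_fract_of_nat: "to_fract (of_nat n) = of_nat n"
  by (induction n) simp_all

lemma d_poly_fract:
  assumes "n \<ge> 1" and q: "q = to_fract [:0, 1:]"
  shows "to_fract (d_poly n) = q / (q + 2) * ((q + 1) ^ n - (- 1) ^ n)"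
    and "to_fract (pderiv (d_poly n))
      = 2 / (q + 2)\<^sup>2 * ((q + 1) ^ n - (- 1) ^ n) + of_nat n * q / (q + 2) * (q + 1) ^ (n - 1)"
proof -
  let ?p = "[:1, 1:] :: int poly"
  define A where "A = (q + 1) ^ n - (- 1) ^ n"
  have "[:2, 1:] = [:0, 1:] + (1 + 1 :: int poly)" by (simp add: one_pCons)
  then have q2: "to_fract [:2, 1:] = q + 2"
    unfolding q by (simp only: to_fract_add to_fract_1 flip: one_add_one)
  have "?p = [:0, 1:] + 1" by (simp add: one_pCons)
  then have q1: "to_fract ?p = q + 1"
    unfolding q by (simp only: to_fract_add to_fract_1)
  have ne: "q + 2 \<noteq> 0"
    unfolding q2[symmetric] by simp
  have m1: "to_fract ((- 1) ^ n) = (- 1) ^ n" by (simp add: to_fract_power)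
  have A: "to_fract (?p ^ n - (- 1) ^ n) = A"
    by (simp only: to_fract_diff to_fract_power q1 m1 A_def) simp
  have cf: "[:2, 1:] * d_poly n = [:0, 1:] * (?p ^ n - (- 1) ^ n)"
    by (rule d_poly_closed_form[OF assms(1)])
  from arg_cong[OF cf, of to_fract] have e1: "(q + 2) * to_fract (d_poly n) = q * A"
    by (simp only: to_fract_mult A q2 q[symmetric])
  then show "to_fract (d_poly n) = q / (q + 2) * ((q + 1) ^ n - (- 1) ^ n)"
    using ne by (simp add: A_def field_simps)
  have pp: "pderiv (?p ^ n - (- 1) ^ n) = of_nat n * ?p ^ (n - 1)"
  proof -
    have "pderiv ((- 1 :: int poly) ^ n) = 0" by (cases "even n") (simp_all add: pderiv_minus)
    then show ?thesis by (simp only: pderiv_diff pderiv_linear_power)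
  qed
  \<comment> \<open>The derivative formula comes from the product rule applied to the identity with
    cleared denominator.\<close>
  from arg_cong[OF cf, of pderiv]
  have "[:2, 1:] * pderiv (d_poly n) + d_poly n
      = [:0, 1:] * (of_nat n * ?p ^ (n - 1)) + (?p ^ n - (- 1) ^ n)"
    unfolding pderiv_mult pp by (simp add: pderiv_pCons)
  from arg_cong[OF this, of to_fract]
  have e2: "(q + 2) * to_fract (pderiv (d_poly n)) + to_fract (d_poly n)
      = q * (of_nat n * (q + 1) ^ (n - 1)) + A"
    by (simp only: to_fract_add to_fract_mult A q2 q[symmetric] to_fract_power q1 to_fract_of_nat)
  define B where "B = of_nat n * (q + 1) ^ (n - 1)"
  have "(q + 2) * to_fract (pderiv (d_poly n)) = q * B + A - to_fract (d_poly n)"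
    using e2 by (simp add: B_def eq_diff_eq)
  \<comment> \<open>A second factor \<open>q + 2\<close> allows \<open>d_poly n\<close> to be
    eliminated by \<open>e1\<close>.\<close>
  then have "(q + 2) * ((q + 2) * to_fract (pderiv (d_poly n))) = (q + 2) * (q * B + A) - q * A"
    by (simp only: right_diff_distrib e1)
  also have "\<dots> = (q + 2) * q * B + 2 * A" by (simp add: algebra_simps)
  finally have "to_fract (pderiv (d_poly n)) = ((q + 2) * q * B + 2 * A) / (q + 2)\<^sup>2"
    using ne by (simp add: eq_divide_eq power2_eq_square mult_ac)
  also have "\<dots> = 2 / (q + 2)\<^sup>2 * A + q / (q + 2) * B"
    using ne by (simp add: add_divide_distrib power2_eq_square)
  finally show "to_fract (pderiv (d_poly n))
      = 2 / (q + 2)\<^sup>2 * ((q + 1) ^ n - (- 1) ^ n) + of_nat n * q / (q + 2) * (q + 1) ^ (n - 1)"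
    by (simp add: A_def B_def)
qed

section \<open>Bounds for the shifted R-polynomials\<close>

context coxeter begin

abbreviation Rs :: "'a \<Rightarrow> 'a \<Rightarrow> int poly" where "Rs \<equiv> shifted_R_poly G S"

lemma Rs_zero: "\<not> bruhat_le G S u w \<Longrightarrow> Rs u w = 0"
  using is_R_family_R_poly by (simp add: is_R_family_def shifted_R_poly_def)

lemma Rs_diag: "w \<in> carrier G \<Longrightarrow> Rs w w = 1"
  using is_R_family_R_poly by (simp add: is_R_family_def shifted_R_poly_def pcompose_1)

lemma Rs_step:
  assumes "u \<in> carrier G" "w \<in> carrier G" "s \<in> S" "len (w \<otimes> s) < len w"
  shows "len (u \<otimes> s) < len u \<Longrightarrow> Rs u w = Rs (u \<otimes> s) (w \<otimes> s)"
    and "len u < len (u \<otimes> s) \<Longrightarrow>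
      Rs u w = [:0, 1:] * Rs u (w \<otimes> s) + [:1, 1:] * Rs (u \<otimes> s) (w \<otimes> s)"
proof -
  let ?R = "R_poly G S"
  have *: "pcompose [:-1, 1:] [:1, 1 :: int:] = [:0, 1:]" "pcompose [:0, 1:] [:1, 1 :: int:] = [:1, 1:]"
    by (simp_all add: pcompose_pCons)
  { assume "len (u \<otimes> s) < len u"
    then have "?R u w = ?R (u \<otimes> s) (w \<otimes> s)"
      using is_R_family_R_poly assms unfolding is_R_family_def by blast
    then show "Rs u w = Rs (u \<otimes> s) (w \<otimes> s)" by (simp add: shifted_R_poly_def) }
  { assume "len u < len (u \<otimes> s)"
    then have "?R u w = [:-1, 1:] * ?R u (w \<otimes> s) + [:0, 1:] * ?R (u \<otimes> s) (w \<otimes> s)"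
      using is_R_family_R_poly assms unfolding is_R_family_def by blast
    then show "Rs u w = [:0, 1:] * Rs u (w \<otimes> s) + [:1, 1:] * Rs (u \<otimes> s) (w \<otimes> s)"
      by (simp only: shifted_R_poly_def pcompose_add pcompose_mult *) }
qed

lemma Rs_bounds:
  assumes "w \<in> carrier G" "bruhat_le G S u w"
  shows "[:0, 1:] ^ (len w - len u) \<preceq>\<^sub>c Rs u w \<and> Rs u w \<preceq>\<^sub>c d_poly (len w - len u)"
  using assms
proof (induction w arbitrary: u rule: descent_induct)
  case one
  then have "u = \<one>" using bruhat_len by fastforce
  then show ?case by (simp add: Rs_diag coeffwise_le_refl)
next
  case (step w s)
  let ?n = "len w - len u"
  have u: "u \<in> carrier G" using step.prems bruhat_closed by blast
  have lw: "len w = Suc (len (w \<otimes> s))" using len_mult_S[of w s] step.hyps by auto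
  show ?case
  proof (cases "len (u \<otimes> s) < len u")
    case True
    then have "len u = Suc (len (u \<otimes> s))" using len_mult_S[of u s] step.hyps u by auto
    \<comment> \<open>Both lengths drop by one, so the length difference and the two bounds stay the
      same.\<close>
    moreover have "bruhat_le G S (u \<otimes> s) (w \<otimes> s)"
      using step.prems step.hyps True by (intro lifting_both)
    ultimately show ?thesis
      using step.IH[of "u \<otimes> s"] Rs_step(1)[OF u step.hyps True] lw by simp
  next
    case False
    then have us: "len (u \<otimes> s) = Suc (len u)" using len_mult_S[of u s] step.hyps u by auto
    then have up: "len u < len (u \<otimes> s)" by simp
    have le: "bruhat_le G S u (w \<otimes> s)"
      using step.prems step.hyps up by (intro lifting_down)
    then have luw: "len u \<le> len (w \<otimes> s)" using bruhat_len by fastforce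
    define k where "k = len (w \<otimes> s) - len u"
    have n: "?n = Suc k" using lw luw by (simp add: k_def)
    note IH = step.IH[OF le, folded k_def]
    have rec: "Rs u w = [:0, 1:] * Rs u (w \<otimes> s) + [:1, 1:] * Rs (u \<otimes> s) (w \<otimes> s)"
      using Rs_step(2)[OF u step.hyps up] .
    \<comment> \<open>The lower bound needs only that the second term is nonnegative, which the
      induction hypothesis gives whenever that term does not vanish.\<close>
    have nonneg: "0 \<preceq>\<^sub>c Rs (u \<otimes> s) (w \<otimes> s)"
    proof (cases "bruhat_le G S (u \<otimes> s) (w \<otimes> s)")
      case True
      show ?thesis
        by (rule coeffwise_le_trans[OF X_power_nonneg conjunct1[OF step.IH[OF True]]])
    qed (simp add: Rs_zero coeffwise_le_refl)
    have "[:0, 1:] ^ Suc k \<preceq>\<^sub>c Rs u w"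
      unfolding rec
      using coeffwise_le_add[OF coeffwise_le_mult_X[OF conjunct1[OF IH]] coeffwise_le_mult_X1[OF nonneg]]
      by simp
    moreover have "Rs u w \<preceq>\<^sub>c d_poly (Suc k)"
    proof (cases "k \<ge> 2")
      case True
      \<comment> \<open>The differences of the two terms are \<open>m + 2\<close> and
        \<open>m + 1\<close>, matching the recurrence for \<open>d_poly (m + 3)\<close>.\<close>
      then obtain m where m: "k = Suc (Suc m)" by (metis add_2_eq_Suc le_Suc_ex)
      have "Rs (u \<otimes> s) (w \<otimes> s) \<preceq>\<^sub>c d_poly (Suc m)"
      proof (cases "bruhat_le G S (u \<otimes> s) (w \<otimes> s)")
        case True
        moreover have "len (w \<otimes> s) - len (u \<otimes> s) = Suc m" using m us by (simp add: k_def)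
        ultimately show ?thesis using step.IH[of "u \<otimes> s"] by simp
      qed (simp add: Rs_zero d_poly_nonneg)
      then show ?thesis
        unfolding rec using coeffwise_le_add[OF coeffwise_le_mult_X[OF conjunct2[OF IH]] coeffwise_le_mult_X1] m
        by simp
    next
      case False
      \<comment> \<open>For \<open>k <= 1\<close> the element \<open>us\<close> is at least as long
        as \<open>ws\<close>, so comparability would force \<open>us = ws\<close>, hence
        \<open>u = w\<close>.\<close>
      have "\<not> bruhat_le G S (u \<otimes> s) (w \<otimes> s)"
      proof
        assume "bruhat_le G S (u \<otimes> s) (w \<otimes> s)"
        then have "u \<otimes> s = w \<otimes> s" using bruhat_len False us k_def by fastforce
        then show False using lw up us u step.hyps by simp
      qed
      then have "Rs u w = [:0, 1:] * Rs u (w \<otimes> s)" using rec by (simp add: Rs_zero)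
      moreover have "[:0, 1:] * d_poly k = d_poly (Suc k)"
      proof -
        \<comment> \<open>The initial values 1, \<open>q\<close>, \<open>q^2\<close> are exactly
          successive multiples by \<open>q\<close>.\<close>
        have "k = 0 \<or> k = 1" using False by auto
        then show ?thesis by (auto simp: power2_eq_square)
      qed
      ultimately show ?thesis using coeffwise_le_mult_X[OF conjunct2[OF IH]] by simp
    qed
    ultimately show ?thesis using n by simp
  qed
qed

end

theorem theorem4:
  fixes G :: "('a, 'b) monoid_scheme" and S :: "'a set" and u w :: 'a and n :: nat
  assumes "coxeter_system G S" and "finite (carrier G)"
    and "bruhat_le G S u w" and "length_diff G S u w = int n" and "n \<ge> 1"
  shows "([:0, 1:] ^ n \<preceq>\<^sub>c shifted_R_poly G S u w \<and> shifted_R_poly G S u w \<preceq>\<^sub>c d_poly n) \<and>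
    (of_nat n * [:0, 1:] ^ (n - 1) \<preceq>\<^sub>c pderiv (shifted_R_poly G S u w) \<and>
      pderiv (shifted_R_poly G S u w) \<preceq>\<^sub>c pderiv (d_poly n)) \<and>
    (let q = to_fract [:0, 1:] in
      to_fract (d_poly n) = q / (q + 2) * ((q + 1) ^ n - (- 1) ^ n) \<and>
      to_fract (pderiv (d_poly n)) =
        2 / (q + 2)\<^sup>2 * ((q + 1) ^ n - (- 1) ^ n) + of_nat n * q / (q + 2) * (q + 1) ^ (n - 1))"
proof -
  interpret group G
    using assms(1) by (auto simp: coxeter_system_def has_presentation_def)
  interpret coxeter G S
    by unfold_locales (rule assms(1))
  have "n = len w - len u" using assms(4) by (simp add: length_diff_def)
  then have bounds: "[:0, 1:] ^ n \<preceq>\<^sub>c Rs u w" "Rs u w \<preceq>\<^sub>c d_poly n"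
    using Rs_bounds[of w u] assms(3) bruhat_closed by auto
  have "of_nat n * [:0, 1:] ^ (n - 1) \<preceq>\<^sub>c pderiv (Rs u w)" "pderiv (Rs u w) \<preceq>\<^sub>c pderiv (d_poly n)"
    using bounds[THEN coeffwise_le_pderiv] by (simp_all only: pderiv_linear_power)
  then show ?thesis
    unfolding Let_def using bounds d_poly_fract[OF assms(5) refl] by blast
qed

end
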